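(* Let $X$ and $Y$ be compact Hausdorff spaces and let $f:X\to Y$ be a light map. Then $w(X)\le w(Y)\cdot \mathrm{Sln}(X)$.
   Context: A continuum is a compact connected Hausdorff space; it is non-degenerate if it has more than one point. For a continuum $K$, the Suslinian number is $\mathrm{Sln}(K)=\sup\{|\mathcal C| : \mathcal C \text{ is a disjoint family of non-degenerate subcontinua of } K\}$. For a Tychonov space $X$, $\mathrm{Sln}(X)=\min\{\mathrm{Sln}(K): K \text{ is a continuum containing } X \text{ (as a subspace, up to homeomorphism)}\}$. $w(X)$ is the weight of $X$, the smallest cardinality of a base of the topology. All maps are continuous. A map $f:X\to Y$ between compact Hausdorff spaces is light if $f^{-1}(y)$ is zero-dimensional for each $y\in Y$.
   Formalization: X is assumed not to be a one-point space: for a single point, X is itself a degenerate continuum, so Sln(X)=0 while w(X)=1, and the inequality w(X) ≤ w(Y)·Sln(X) fails. *)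

theory Defs
  imports "HOL-Analysis.Analysis"
begin

unbundle cardinal_syntax

section \<open>Minima and suprema of cardinals\<close>

text \<open>
  Cardinal numbers are represented by cardinal orders, compared with \<open>\<le>o\<close> (no cardinal is
  assumed to be infinite). Minimal elements are unique up to \<open>=o\<close>, so the choice made
  by \<open>SOME\<close> is irrelevant; it is meaningful only for a nonempty set of cardinals.
\<close>

definition card_min :: "'b rel set \<Rightarrow> 'b rel" where
  "card_min R = (SOME r. r \<in> R \<and> (\<forall>s\<in>R. r \<le>o s))"

text \<open>
  All upper bounds considered live on the type \<open>'b\<close>; this loses nothing, since \<open>|UNIV :: 'b set|\<close>
  is one of them and every smaller cardinal has a representative on \<open>'b\<close>.
\<close>

definition card_sup :: "'b rel set \<Rightarrow> 'b rel" where
  "card_sup R = card_min {r. Card_order r \<and> (\<forall>s\<in>R. s \<le>o r)}"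

lemma card_min:
  assumes "R \<noteq> {}" and "\<And>r. r \<in> R \<Longrightarrow> Card_order r"
  shows "card_min R \<in> R" and "\<And>s. s \<in> R \<Longrightarrow> card_min R \<le>o s"
proof -
  have "\<exists>r. r \<in> R \<and> (\<forall>s\<in>R. r \<le>o s)"
    using exists_minim_Card_order[of R] assms by blast
  then have "card_min R \<in> R \<and> (\<forall>s\<in>R. card_min R \<le>o s)"
    unfolding card_min_def by (rule someI_ex)
  then show "card_min R \<in> R" and "\<And>s. s \<in> R \<Longrightarrow> card_min R \<le>o s"
    by blast+
qed

lemma card_sup:
  fixes R :: "'b rel set"
  assumes "\<And>r. r \<in> R \<Longrightarrow> Card_order r"
  shows "Card_order (card_sup R)"
    and "\<And>s. s \<in> R \<Longrightarrow> s \<le>o card_sup R"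
    and "\<And>r :: 'b rel. Card_order r \<Longrightarrow> (\<And>s. s \<in> R \<Longrightarrow> s \<le>o r) \<Longrightarrow> card_sup R \<le>o r"
proof -
  let ?U = "{r :: 'b rel. Card_order r \<and> (\<forall>s\<in>R. s \<le>o r)}"
  have "s \<le>o |UNIV :: 'b set|" if "s \<in> R" for s
  proof -
    have "|Field s| =o s"
      using assms[OF that] by (rule card_of_Field_ordIso)
    moreover have "|Field s| \<le>o |UNIV :: 'b set|"
      by (rule card_of_mono1) simp
    ultimately show ?thesis
      by (rule ordIso_ordLeq_trans[OF ordIso_symmetric])
  qed
  then have "|UNIV :: 'b set| \<in> ?U"
    using card_of_Card_order[of "UNIV :: 'b set"] by simp
  then have ne: "?U \<noteq> {}"
    by blast
  have "card_sup R \<in> ?U"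
    unfolding card_sup_def by (rule card_min(1)[OF ne]) blast
  then show "Card_order (card_sup R)" and "\<And>s. s \<in> R \<Longrightarrow> s \<le>o card_sup R"
    by blast+
  show "card_sup R \<le>o r" if "Card_order r" "\<And>s. s \<in> R \<Longrightarrow> s \<le>o r" for r :: "'b rel"
    unfolding card_sup_def by (rule card_min(2)[OF ne]) (use that in blast)+
qed

section \<open>Weight\<close>

definition is_base :: "'a topology \<Rightarrow> 'a set set \<Rightarrow> bool" where
  "is_base X \<B> \<longleftrightarrow> (\<forall>V\<in>\<B>. openin X V) \<and>
     (\<forall>U x. openin X U \<and> x \<in> U \<longrightarrow> (\<exists>V\<in>\<B>. x \<in> V \<and> V \<subseteq> U))"

definition weight :: "'a topology \<Rightarrow> 'a set rel" where
  "weight X = card_min {|\<B>| | \<B>. is_base X \<B>}"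

lemma is_base_all_open: "is_base X {U. openin X U}"
  unfolding is_base_def by auto

section \<open>Light maps\<close>

definition zero_dimensional :: "'a topology \<Rightarrow> bool" where
  "zero_dimensional X \<longleftrightarrow> is_base X {V. openin X V \<and> closedin X V}"

text \<open>Empty fibres count as zero-dimensional, so light maps need not be surjective.\<close>

definition light_map :: "'a topology \<Rightarrow> 'b topology \<Rightarrow> ('a \<Rightarrow> 'b) \<Rightarrow> bool" where
  "light_map X Y f \<longleftrightarrow> continuous_map X Y f \<and>
     (\<forall>y\<in>topspace Y. zero_dimensional (subtopology X {x \<in> topspace X. f x = y}))"

section \<open>The Suslinian number\<close>

definition continuum :: "'a topology \<Rightarrow> bool" where
  "continuum K \<longleftrightarrow> compact_space K \<and> connected_space K \<and> Hausdorff_space K"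

definition nondegenerate_subcontinuum :: "'a topology \<Rightarrow> 'a set \<Rightarrow> bool" where
  "nondegenerate_subcontinuum K C \<longleftrightarrow>
     C \<subseteq> topspace K \<and> continuum (subtopology K C) \<and> (\<exists>x\<in>C. \<exists>y\<in>C. x \<noteq> y)"

definition Sln_continuum :: "'k topology \<Rightarrow> 'k set rel" where
  "Sln_continuum K =
     card_sup {|\<C>| | \<C>. (\<forall>C\<in>\<C>. nondegenerate_subcontinuum K C) \<and> pairwise disjnt \<C>}"

text \<open>
  The minimum defining the Suslinian number of a space \<open>X\<close> ranges over the proper class of all
  continua that contain a copy of \<open>X\<close>. Here it ranges over those whose points are of
  type \<open>'k\<close>. The type \<open>'k\<close> is arbitrary and unrelated to the type of the points of \<open>X\<close>,
  so that a theorem polymorphic in \<open>'k\<close> covers all continua. The minimum makes sense when \<open>'k\<close> hosts at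
  least one such continuum, which is the predicate \<open>embeds_in_continuum\<close>.
\<close>

definition embeds_in_continuum :: "'k itself \<Rightarrow> 'a topology \<Rightarrow> bool" where
  "embeds_in_continuum _ X \<longleftrightarrow>
     (\<exists>(K :: 'k topology) e. continuum K \<and> embedding_map X K e)"

definition Sln :: "'k itself \<Rightarrow> 'a topology \<Rightarrow> 'k set rel" where
  "Sln _ X =
     card_min {Sln_continuum K | K :: 'k topology. continuum K \<and> (\<exists>e. embedding_map X K e)}"

lemma Card_order_Sln_continuum: "Card_order (Sln_continuum K)"
  unfolding Sln_continuum_def using card_of_Card_order by (intro card_sup(1)) blast

text \<open>Every Tychonov space embeds in a Tychonov cube, so suitable types \<open>'k\<close> exist.\<close>

lemma Tychonov_embeds_in_continuum:
  fixes X :: "'a topology"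
  assumes "completely_regular_space X" and "Hausdorff_space X"
  shows "embeds_in_continuum TYPE(('a \<Rightarrow> real) \<Rightarrow> real) X"
proof -
  obtain I :: "('a \<Rightarrow> real) set" and e
    where e: "embedding_map X (product_topology (\<lambda>f. top_of_set {0..1::real}) I) e"
    using completely_regular_space_cube_embedding[OF assms] by blast
  have "continuum (product_topology (\<lambda>f. top_of_set {0..1::real}) I)"
    unfolding continuum_def
    by (simp add: compact_space_product_topology connected_space_product_topology
        Hausdorff_space_product_topology compact_space_subtopology
        connected_space_subtopology Hausdorff_space_subtopology)
  with e show ?thesis
    unfolding embeds_in_continuum_def by blast
qed

end

theory Submission
  imports Defs
begin

text \<open>
  Let \<open>K\<close> be a continuum that contains \<open>X\<close> and realises the Suslinian number \<open>\<kappa>\<close>, and put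
  \<open>\<mu> = w(Y) \<sqdot> \<kappa>\<close>. If \<open>X\<close> has at least two points, then \<open>K\<close> is non-degenerate, every
  non-degenerate continuum contains two disjoint ones, and so \<open>\<kappa>\<close> and \<open>\<mu>\<close> are infinite
  (\<open>Cinfinite_Sln_continuum\<close>). For a singleton the inequality fails: \<open>K\<close> may be a point, and then
  \<open>\<kappa> = 0\<close> while \<open>w(X) = 1\<close>. In a compact Hausdorff space, a network of closed sets
  of infinite size \<open>\<mu>\<close> yields a base of size at most \<open>\<mu>\<close> (\<open>weight_le_closed_network\<close>), hence it is
  enough to find at most \<open>\<mu>\<close> closed sets in \<open>K\<close> that form a network at the points of \<open>X\<close>.

  Their source is the definition of \<open>\<kappa>\<close>: the components of any set are pairwise disjoint, so at most
  \<open>\<kappa>\<close> of those of a closed set are non-degenerate, and by boundary bumping the component of an interior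
  point is non-degenerate. Suppose that \<open>\<W>\<close> is a family of at most \<open>\<mu>\<close> open sets of \<open>K\<close> such that, for
  \<open>x \<in> X\<close>, the intersection of the closures of all \<open>W \<in> \<W>\<close> with \<open>x \<in> W\<close> has component \<open>{x}\<close> at \<open>x\<close>.
  By compactness the components at \<open>x\<close> of finite subintersections shrink to \<open>x\<close>; hence the
  non-degenerate components of finite intersections of closures form the desired network
  (\<open>closed_network_of_components\<close>).

  The family \<open>\<W>\<close> is obtained from two kinds of closed sets that have to be separated in \<open>K\<close>
  (\<open>separating_family_of_light_preimage\<close>). For basic open sets \<open>U, V\<close> of \<open>Y\<close> such that \<open>V\<close> contains the
  closure of \<open>U\<close>, separate the preimages of this closure and of the complement of \<open>V\<close>; this confines
  the part in \<open>X\<close> of a component to a fibre of \<open>f\<close>. Moreover choose a maximal disjoint family \<open>\<M>\<close> of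
  non-degenerate subcontinua of \<open>K\<close> that miss \<open>X\<close>, of size at most \<open>\<kappa>\<close>, and separate \<open>X\<close>
  from each of its members. A non-degenerate continuum that survives all separations meets \<open>X\<close> only
  within one fibre, which is zero-dimensional. So it is not contained in \<open>X\<close>, hence
  contains a non-degenerate continuum that misses \<open>X\<close> and every member of \<open>\<M>\<close>. This contradicts the
  maximality of \<open>\<M>\<close>.
\<close>

section \<open>Cardinal bounds\<close>

text \<open>
  Stratify by size: a set with \<open>n + 1\<close> elements arises from a pair in \<open>A \<times> P n\<close>, and \<open>r\<close> absorbs
  products and countable unions.
\<close>

lemma finite_subsets_Cinfinite_bound:
  assumes r: "Cinfinite r" and A: "|A| \<le>o r"
  shows "|{F. finite F \<and> F \<subseteq> A}| \<le>o r"
proof -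
  define P where "P n = {F. finite F \<and> F \<subseteq> A \<and> card F = n}" for n
  have "|P n| \<le>o r" for n
  proof (induction n)
    case 0
    have "finite (P 0)"
      by (auto simp: P_def intro: finite_subset[of _ "{{}}"])
    then have "|P 0| <o r"
      using r by (intro Cfinite_ordLess_Cinfinite) (auto simp: cfinite_def Field_card_of card_of_card_order_on)
    then show ?case
      by (rule ordLess_imp_ordLeq)
  next
    case (Suc n)
    have "P (Suc n) \<subseteq> (\<lambda>(a, F). insert a F) ` (A \<times> P n)"
    proof
      fix F assume F: "F \<in> P (Suc n)"
      then obtain a G where "F = insert a G" "a \<notin> G" "card G = n" "finite G"
        by (auto simp: P_def card_Suc_eq_finite)
      with F show "F \<in> (\<lambda>(a, F). insert a F) ` (A \<times> P n)"
        by (auto simp: P_def intro!: rev_image_eqI[of "(a, G)"])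
    qed
    moreover have "|A \<times> P n| \<le>o r"
      using card_of_Times_ordLeq_infinite_Field[OF _ A Suc] r by (simp add: cinfinite_def)
    ultimately show ?case
      by (meson card_of_image card_of_mono1 ordLeq_transitive)
  qed
  moreover have "|UNIV :: nat set| \<le>o r"
    using natLeq_ordLeq_cinfinite[OF r] card_of_nat ordIso_ordLeq_trans by blast
  ultimately have "|\<Union>n. P n| \<le>o r"
    using r by (intro UNION_Cinfinite_bound) auto
  moreover have "{F. finite F \<and> F \<subseteq> A} = (\<Union>n. P n)"
    by (auto simp: P_def)
  ultimately show ?thesis
    by simp
qed

lemma finite_Inter_Cinfinite_bound:
  assumes "Cinfinite r" and "|\<S>| \<le>o r"
  shows "|{T \<inter> \<Inter>F | F. finite F \<and> F \<subseteq> \<S>}| \<le>o r"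
proof -
  have eq: "{T \<inter> \<Inter>F | F. finite F \<and> F \<subseteq> \<S>} = (\<lambda>F. T \<inter> \<Inter>F) ` {F. finite F \<and> F \<subseteq> \<S>}"
    by auto
  show ?thesis
    unfolding eq by (rule ordLeq_transitive[OF card_of_image finite_subsets_Cinfinite_bound[OF assms]])
qed

lemma image_pairs_Cinfinite_bound:
  assumes "Cinfinite r" and "|A| \<le>o r"
  shows "|{h a b | a b. a \<in> A \<and> b \<in> A}| \<le>o r"
proof -
  have eq: "{h a b | a b. a \<in> A \<and> b \<in> A} = (\<lambda>(a, b). h a b) ` (A \<times> A)"
    by auto
  have "|A \<times> A| \<le>o r"
    using assms by (intro card_of_Times_ordLeq_infinite_Field) (auto simp: cinfinite_def)
  then show ?thesis
    unfolding eq by (rule ordLeq_transitive[OF card_of_image])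
qed

section \<open>Weight of compact Hausdorff spaces\<close>

lemma weight_le:
  assumes "is_base X \<B>"
  shows "weight X \<le>o |\<B>|"
  unfolding weight_def by (rule card_min(2)) (use assms in \<open>auto simp: card_of_Card_order\<close>)

lemma weight_attained:
  obtains \<B> where "is_base X \<B>" and "weight X = |\<B>|"
proof -
  have "weight X \<in> {|\<B>| | \<B>. is_base X \<B>}"
    unfolding weight_def by (rule card_min(1)) (use is_base_all_open in \<open>auto simp: card_of_Card_order\<close>)
  then show ?thesis
    using that by blast
qed

lemma compact_Inter_subset_open:
  assumes X: "compact_space X" and cl: "\<And>C. C \<in> \<S> \<Longrightarrow> closedin X C"
    and W: "openin X W" and sub: "topspace X \<inter> \<Inter>\<S> \<subseteq> W"
  obtains F where "finite F" "F \<subseteq> \<S>" "topspace X \<inter> \<Inter>F \<subseteq> W"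
proof -
  have "compactin X (topspace X - W)"
    using X W closedin_compact_space by blast
  moreover have "(topspace X - W) \<inter> \<Inter>\<S> = {}"
    using sub by blast
  ultimately obtain F where "finite F" "F \<subseteq> \<S>" "(topspace X - W) \<inter> \<Inter>F = {}"
    unfolding compactin_fip using cl by meson
  then show ?thesis
    by (intro that[of F]) auto
qed

text \<open>
  Separation as a function of the two closed sets: a family of pairs then yields at most as many open
  sets as it has members.
\<close>

lemma normal_separator:
  assumes "normal_space X"
  obtains sep where
    "\<And>S T. closedin X S \<Longrightarrow> closedin X T \<Longrightarrow> disjnt S T \<Longrightarrow>
      openin X (sep S T) \<and> S \<subseteq> sep S T \<and> disjnt T (X closure_of sep S T)"
  using assms unfolding normal_space by metis

text \<open>
  The closures of the members of \<open>\<G>\<close> that contain \<open>x\<close> intersect in \<open>{x}\<close>, so finitely many of them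
  fit into a given neighbourhood of \<open>x\<close>. This is the reason why a compact topology has no strictly
  coarser Hausdorff topology.
\<close>

lemma is_base_finite_Inter:
  assumes X: "compact_space X" and op: "\<And>G. G \<in> \<G> \<Longrightarrow> openin X G"
    and sep: "\<And>x y. x \<in> topspace X \<Longrightarrow> y \<in> topspace X \<Longrightarrow> x \<noteq> y \<Longrightarrow>
      \<exists>G\<in>\<G>. x \<in> G \<and> y \<notin> X closure_of G"
  shows "is_base X {topspace X \<inter> \<Inter>F | F. finite F \<and> F \<subseteq> \<G>}"
  unfolding is_base_def
proof (intro conjI ballI allI impI)
  fix V assume "V \<in> {topspace X \<inter> \<Inter>F | F. finite F \<and> F \<subseteq> \<G>}"
  then obtain F where F: "V = topspace X \<inter> \<Inter>F" "finite F" "F \<subseteq> \<G>"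
    by blast
  have "openin X (\<Inter>F)" if "F \<noteq> {}"
    using F op that by (intro openin_Inter) auto
  then show "openin X V"
    using F by (cases "F = {}") auto
next
  fix U x assume Ux: "openin X U \<and> x \<in> U"
  then have x: "x \<in> topspace X"
    using openin_subset by blast
  define \<C> where "\<C> = {G \<in> \<G>. x \<in> G}"
  have "topspace X \<inter> \<Inter>((closure_of) X ` \<C>) \<subseteq> U"
    using sep[OF x] Ux unfolding \<C>_def by auto
  moreover have "closedin X C" if "C \<in> (closure_of) X ` \<C>" for C
    using that by auto
  ultimately obtain F where "finite F" "F \<subseteq> (closure_of) X ` \<C>" "topspace X \<inter> \<Inter>F \<subseteq> U"
    using compact_Inter_subset_open[OF X, of "(closure_of) X ` \<C>" U] Ux by metis
  then obtain F' where F': "finite F'" "F' \<subseteq> \<C>" "topspace X \<inter> \<Inter>((closure_of) X ` F') \<subseteq> U"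
    using finite_subset_image by metis
  have "G \<subseteq> X closure_of G" if "G \<in> F'" for G
    using that F' op by (intro closure_of_subset openin_subset) (auto simp: \<C>_def)
  then have "topspace X \<inter> \<Inter>F' \<subseteq> U"
    using F'(3) by blast
  moreover have "x \<in> topspace X \<inter> \<Inter>F'"
    using x F' by (auto simp: \<C>_def)
  ultimately show "\<exists>V\<in>{topspace X \<inter> \<Inter>F | F. finite F \<and> F \<subseteq> \<G>}. x \<in> V \<and> V \<subseteq> U"
    using F' unfolding \<C>_def by blast
qed

text \<open>
  The members of a network cannot serve as a base because they need not be open. But distinct points
  lie in disjoint members of the network, and an open set that separates such a pair of members
  separates the points.
\<close>

lemma weight_le_closed_network:
  assumes X: "compact_space X" "Hausdorff_space X" and r: "Cinfinite r" and D: "|\<D>| \<le>o r"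
    and cl: "\<And>D. D \<in> \<D> \<Longrightarrow> closedin X D"
    and net: "\<And>x U. openin X U \<Longrightarrow> x \<in> U \<Longrightarrow> \<exists>D\<in>\<D>. x \<in> D \<and> D \<subseteq> U"
  shows "weight X \<le>o r"
proof -
  obtain sep where sep: "\<And>S T. closedin X S \<Longrightarrow> closedin X T \<Longrightarrow> disjnt S T \<Longrightarrow>
      openin X (sep S T) \<and> S \<subseteq> sep S T \<and> disjnt T (X closure_of sep S T)"
    using normal_separator compact_Hausdorff_or_regular_imp_normal_space X by metis
  \<comment> \<open>At pairs of sets that are not disjoint, \<open>sep\<close> is arbitrary and need not be open.\<close>
  define \<G> where "\<G> = {G \<in> {sep S T | S T. S \<in> \<D> \<and> T \<in> \<D>}. openin X G}"
  have "is_base X {topspace X \<inter> \<Inter>F | F. finite F \<and> F \<subseteq> \<G>}"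
  proof (rule is_base_finite_Inter[OF X(1)])
    show "openin X G" if "G \<in> \<G>" for G
      using that by (simp add: \<G>_def)
    fix x y assume "x \<in> topspace X" "y \<in> topspace X" "x \<noteq> y"
    then obtain U V where UV: "openin X U" "openin X V" "x \<in> U" "y \<in> V" "disjnt U V"
      using X(2) unfolding Hausdorff_space_def by metis
    obtain S T where ST: "S \<in> \<D>" "x \<in> S" "S \<subseteq> U" "T \<in> \<D>" "y \<in> T" "T \<subseteq> V"
      using net UV by meson
    then have "disjnt S T"
      using UV(5) by (meson disjnt_subset1 disjnt_subset2)
    then show "\<exists>G\<in>\<G>. x \<in> G \<and> y \<notin> X closure_of G"
      using sep[OF cl cl, of S T] ST
      by (intro bexI[of _ "sep S T"]) (auto simp: \<G>_def disjnt_iff)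
  qed
  moreover have "|\<G>| \<le>o r"
    by (rule ordLeq_transitive[OF card_of_mono1 image_pairs_Cinfinite_bound[OF r D, of sep]])
      (auto simp: \<G>_def)
  ultimately show ?thesis
    using weight_le finite_Inter_Cinfinite_bound[OF r] ordLeq_transitive by blast
qed

section \<open>Subcontinua\<close>

lemma nondegenerate_subcontinuum_closedin:
  assumes "Hausdorff_space K" and "nondegenerate_subcontinuum K C"
  shows "closedin K C"
  using assms unfolding nondegenerate_subcontinuum_def continuum_def
  by (simp add: compactin_imp_closedin compactin_subspace)

lemma nondegenerate_subcontinuum_iff:
  assumes "compact_space K" and "Hausdorff_space K"
  shows "nondegenerate_subcontinuum K C \<longleftrightarrow>
    closedin K C \<and> connectedin K C \<and> (\<exists>x\<in>C. \<exists>y\<in>C. x \<noteq> y)"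
proof
  assume C: "nondegenerate_subcontinuum K C"
  then show "closedin K C \<and> connectedin K C \<and> (\<exists>x\<in>C. \<exists>y\<in>C. x \<noteq> y)"
    using nondegenerate_subcontinuum_closedin[OF assms(2) C]
    by (auto simp: nondegenerate_subcontinuum_def continuum_def connectedin_def)
next
  assume C: "closedin K C \<and> connectedin K C \<and> (\<exists>x\<in>C. \<exists>y\<in>C. x \<noteq> y)"
  then have "compact_space (subtopology K C)"
    using assms closedin_compact_space compact_space_subtopology by blast
  with C show "nondegenerate_subcontinuum K C"
    using assms closedin_subset
    by (auto simp: nondegenerate_subcontinuum_def continuum_def connectedin_def
        Hausdorff_space_subtopology)
qed

lemma nondegenerate_subcontinuum_trans:
  assumes "nondegenerate_subcontinuum K C" and "nondegenerate_subcontinuum (subtopology K C) D"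
  shows "nondegenerate_subcontinuum K D" and "D \<subseteq> C"
  using assms by (auto simp: nondegenerate_subcontinuum_def subtopology_subtopology Int_absorb1)

text \<open>
  A weak form of boundary bumping: small continua exist around every point of a continuum.
\<close>

lemma nondegenerate_subcontinuum_in_open:
  assumes K: "continuum K" and U: "openin K U" "x \<in> U" and y: "y \<in> topspace K" "y \<noteq> x"
  obtains D where "nondegenerate_subcontinuum K D" "x \<in> D" "D \<subseteq> U"
proof -
  have x: "x \<in> topspace K"
    using U openin_subset by blast
  obtain D where D: "compactin K D" "connectedin K D" "{x} \<subset> D" "D \<subset> U"
  proof (rule intermediate_continuum_exists[of K "{x}" U])
    show "connected_space K" "locally_compact_space K" "Hausdorff_space K"
      using K by (auto simp: continuum_def compact_imp_locally_compact_space)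
  qed (use x y U in auto)
  have "nondegenerate_subcontinuum K D"
    using D K by (auto simp: nondegenerate_subcontinuum_iff continuum_def compactin_imp_closedin)
  then show ?thesis
    using D that by blast
qed

lemma two_disjoint_subcontinua:
  assumes C: "nondegenerate_subcontinuum K C"
  obtains D E where "nondegenerate_subcontinuum K D" "nondegenerate_subcontinuum K E"
    "D \<subseteq> C" "E \<subseteq> C" "disjnt D E"
proof -
  let ?C = "subtopology K C"
  have cont: "continuum ?C" and top: "topspace ?C = C"
    using C by (auto simp: nondegenerate_subcontinuum_def)
  obtain x y where xy: "x \<in> C" "y \<in> C" "x \<noteq> y"
    using C by (auto simp: nondegenerate_subcontinuum_def)
  then obtain U V where UV: "openin ?C U" "openin ?C V" "x \<in> U" "y \<in> V" "disjnt U V"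
    using cont top unfolding continuum_def Hausdorff_space_def by metis
  obtain D where D: "nondegenerate_subcontinuum ?C D" "D \<subseteq> U"
    using nondegenerate_subcontinuum_in_open[OF cont UV(1,3), of y] xy top by blast
  obtain E where E: "nondegenerate_subcontinuum ?C E" "E \<subseteq> V"
    using nondegenerate_subcontinuum_in_open[OF cont UV(2,4), of x] xy top by blast
  show ?thesis
    using that[of D E] nondegenerate_subcontinuum_trans[OF C] D E UV(5)
    by (meson disjnt_subset1 disjnt_subset2)
qed

section \<open>The Suslinian number\<close>

lemma card_le_Sln_continuum:
  assumes "\<And>C. C \<in> \<C> \<Longrightarrow> nondegenerate_subcontinuum K C" and "pairwise disjnt \<C>"
  shows "|\<C>| \<le>o Sln_continuum K"
  unfolding Sln_continuum_def
  by (rule card_sup(2)) (use assms card_of_Card_order in blast)+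

text \<open>
  Replacing one member of the family by two disjoint subcontinua of it makes room for one more.
\<close>

lemma finite_disjoint_subcontinua:
  assumes K: "continuum K" and xy: "x \<in> topspace K" "y \<in> topspace K" "x \<noteq> y"
  shows "\<exists>\<C>. finite \<C> \<and> card \<C> = Suc n \<and>
    (\<forall>C\<in>\<C>. nondegenerate_subcontinuum K C) \<and> pairwise disjnt \<C>"
proof (induction n)
  case 0
  have "nondegenerate_subcontinuum K (topspace K)"
    using K xy by (auto simp: nondegenerate_subcontinuum_def)
  then show ?case
    by (intro exI[of _ "{topspace K}"]) (auto simp: pairwise_def)
next
  case (Suc n)
  then obtain \<C> where \<C>: "finite \<C>" "card \<C> = Suc n"
    "\<forall>C\<in>\<C>. nondegenerate_subcontinuum K C" "pairwise disjnt \<C>"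
    by blast
  then obtain C where C: "C \<in> \<C>"
    by (metis card_gt_0_iff ex_in_conv zero_less_Suc)
  then obtain D E where DE: "nondegenerate_subcontinuum K D" "nondegenerate_subcontinuum K E"
    "D \<subseteq> C" "E \<subseteq> C" "disjnt D E"
    using two_disjoint_subcontinua \<C>(3) by metis
  have ne: "D \<noteq> {}" "E \<noteq> {}"
    using DE by (auto simp: nondegenerate_subcontinuum_def)
  have dis: "disjnt D B \<and> disjnt E B" if "B \<in> \<C> - {C}" for B
    using \<C>(4) C that DE(3,4) unfolding pairwise_def disjnt_iff by blast
  have new: "D \<notin> \<C> - {C}" "E \<notin> \<C> - {C}" "D \<noteq> E"
    using dis ne DE(5) by (auto simp: disjnt_iff)
  have "card (insert D (insert E (\<C> - {C}))) = Suc (Suc n)"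
    using \<C>(1,2) C new by simp
  moreover have "pairwise disjnt (insert D (insert E (\<C> - {C})))"
    using \<C>(4) dis DE(5) by (auto simp: pairwise_def disjnt_sym)
  ultimately show ?case
    using \<C>(1,3) DE(1,2) by (intro exI[of _ "insert D (insert E (\<C> - {C}))"]) auto
qed

lemma Cinfinite_Sln_continuum:
  assumes "continuum K" and "x \<in> topspace K" "y \<in> topspace K" "x \<noteq> y"
  shows "Cinfinite (Sln_continuum K)"
proof -
  have "infinite (Field (Sln_continuum K))"
  proof
    assume fin: "finite (Field (Sln_continuum K))"
    obtain \<C> where \<C>: "finite \<C>" "card \<C> = Suc (card (Field (Sln_continuum K)))"
      "\<forall>C\<in>\<C>. nondegenerate_subcontinuum K C" "pairwise disjnt \<C>"
      using finite_disjoint_subcontinua[OF assms] by blast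
    have "|\<C>| \<le>o |Field (Sln_continuum K)|"
      using card_le_Sln_continuum[of \<C> K] \<C> Card_order_Sln_continuum
        card_of_Field_ordIso ordIso_symmetric ordLeq_ordIso_trans by blast
    then obtain f where "inj_on f \<C>" "f ` \<C> \<subseteq> Field (Sln_continuum K)"
      using card_of_ordLeq by metis
    then show False
      using card_inj_on_le[OF _ _ fin] \<C>(2) by fastforce
  qed
  then show ?thesis
    by (simp add: cinfinite_def Card_order_Sln_continuum)
qed

section \<open>Networks from components\<close>

text \<open>
  In the compact space \<open>L = \<Inter>\<N>\<close> the component \<open>{x}\<close> is also a quasicomponent, so \<open>L\<close> splits into two
  disjoint closed sets, of which one contains \<open>x\<close> and lies in \<open>U\<close>. Disjoint open neighbourhoods of the two
  parts still cover some finite subintersection, and a connected set in their union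
  that contains \<open>x\<close> cannot leave the first one.
\<close>

lemma component_of_finite_Inter_subset_open:
  assumes K: "compact_space K" "Hausdorff_space K"
    and cl: "\<And>N. N \<in> \<N> \<Longrightarrow> closedin K N" and x: "\<And>N. N \<in> \<N> \<Longrightarrow> x \<in> N"
    and triv: "\<And>C. connectedin K C \<Longrightarrow> x \<in> C \<Longrightarrow> C \<subseteq> \<Inter>\<N> \<Longrightarrow> C \<subseteq> {x}"
    and U: "openin K U" "x \<in> U"
  obtains F where "finite F" "F \<subseteq> \<N>"
    "connected_component_of_set (subtopology K (topspace K \<inter> \<Inter>F)) x \<subseteq> U"
proof -
  have xK: "x \<in> topspace K"
    using U openin_subset by blast
  define L where "L = topspace K \<inter> \<Inter>\<N>"
  have "closedin K (\<Inter>\<N>)" if "\<N> \<noteq> {}"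
    using that cl by blast
  then have L: "closedin K L"
    unfolding L_def by (cases "\<N> = {}") auto
  have xL: "x \<in> L"
    using x xK by (auto simp: L_def)
  let ?L = "subtopology K L"
  have top: "topspace ?L = L"
    using L closedin_subset by auto
  have "separated_between ?L {x} (L - U)"
  proof (rule cut_wire_fence_theorem)
    show "compact_space ?L"
      using K(1) L closedin_compact_space compact_space_subtopology by blast
    show haus: "Hausdorff_space ?L"
      using K(2) Hausdorff_space_subtopology by blast
    show "closedin ?L {x}"
      using closedin_Hausdorff_singleton[OF haus, of x] xL unfolding top .
    have "openin ?L (U \<inter> L)"
      using U by (auto simp: openin_subtopology)
    then have "closedin ?L (topspace ?L - U \<inter> L)"
      by blast
    then show "closedin ?L (L - U)"
      unfolding top by (simp add: Diff_Int_distrib Diff_Int)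
    show "disjnt C {x} \<or> disjnt C (L - U)" if "connectedin ?L C" for C
      using that triv[of C] U(2) by (auto simp: connectedin_subtopology L_def disjnt_iff)
  qed
  then obtain P Q where PQ: "closedin ?L P" "closedin ?L Q" "P \<union> Q = L" "disjnt P Q"
      "x \<in> P" "L - U \<subseteq> Q"
    unfolding separated_between_alt top by auto
  have PQK: "closedin K P" "closedin K Q"
    using PQ(1,2) L closedin_trans_full by blast+
  have "normal_space K"
    using K compact_Hausdorff_or_regular_imp_normal_space by blast
  then obtain V W where VW: "openin K V" "openin K W" "P \<subseteq> V" "Q \<subseteq> W" "disjnt V W"
    using PQK PQ(4) unfolding normal_space_def by metis
  have "P \<subseteq> U"
    using PQ by (auto simp: disjnt_iff)
  have "openin K ((V \<inter> U) \<union> W)"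
    using VW U by blast
  moreover have "topspace K \<inter> \<Inter>\<N> \<subseteq> (V \<inter> U) \<union> W"
    using PQ(3) VW(3,4) \<open>P \<subseteq> U\<close> unfolding L_def by blast
  ultimately obtain F where F: "finite F" "F \<subseteq> \<N>" "topspace K \<inter> \<Inter>F \<subseteq> (V \<inter> U) \<union> W"
    using compact_Inter_subset_open[OF K(1) cl] by metis
  let ?C = "connected_component_of_set (subtopology K (topspace K \<inter> \<Inter>F)) x"
  have "connectedin (subtopology K (topspace K \<inter> \<Inter>F)) ?C"
    by (rule connectedin_connected_component_of)
  then have C: "connectedin K ?C" "?C \<subseteq> topspace K \<inter> \<Inter>F"
    by (auto simp: connectedin_subtopology)
  have "x \<in> topspace (subtopology K (topspace K \<inter> \<Inter>F))"
    using xK x F(2) by auto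
  then have xC: "x \<in> ?C"
    by (simp add: connected_component_of_refl)
  have "?C \<inter> W = {}"
  proof -
    have "?C \<subseteq> (V \<inter> U) \<union> W"
      using C(2) F(3) by (rule subset_trans)
    moreover have "(V \<inter> U) \<inter> W = {}"
      using VW(5) by (auto simp: disjnt_iff)
    moreover have "x \<in> V \<inter> U"
      using PQ(5) VW(3) U(2) by blast
    ultimately show ?thesis
      using C(1) xC openin_Int[OF VW(1) U(1)] VW(2) unfolding connectedin by blast
  qed
  then have "?C \<subseteq> U"
    using C(2) F(3) by blast
  then show ?thesis
    using that F(1,2) by blast
qed

lemma card_nondegenerate_components_le:
  shows "|{D \<in> connected_components_of (subtopology K N). nondegenerate_subcontinuum K D}|
    \<le>o Sln_continuum K"
proof (rule card_le_Sln_continuum)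
  show "pairwise disjnt {D \<in> connected_components_of (subtopology K N). nondegenerate_subcontinuum K D}"
    by (rule pairwise_subset[OF pairwise_disjoint_connected_components_of]) auto
qed auto

text \<open>
  Each \<open>a \<in> A\<close> is interior to every finite intersection \<open>N\<close> of closures of sets \<open>W \<in> \<W>\<close> with \<open>a \<in> W\<close>.
  Therefore the component of \<open>a\<close> in \<open>N\<close> is one of the non-degenerate ones, which are few.
\<close>

lemma closed_network_of_components:
  assumes K: "continuum K" and two: "\<exists>p\<in>topspace K. \<exists>q\<in>topspace K. p \<noteq> q"
    and W: "|\<W>| \<le>o r" "\<forall>W\<in>\<W>. openin K W"
    and triv: "\<forall>a\<in>A. \<forall>C. connectedin K C \<and> a \<in> C \<and> (\<forall>W\<in>\<W>. a \<in> W \<longrightarrow> C \<subseteq> K closure_of W)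
      \<longrightarrow> C \<subseteq> {a}"
    and r: "Cinfinite r" "Sln_continuum K \<le>o r"
  obtains \<D> where "|\<D>| \<le>o r" "\<And>D. D \<in> \<D> \<Longrightarrow> closedin K D"
    "\<And>a U. openin K U \<Longrightarrow> a \<in> A \<Longrightarrow> a \<in> U \<Longrightarrow> \<exists>D\<in>\<D>. a \<in> D \<and> D \<subseteq> U"
proof -
  have cK: "compact_space K" "Hausdorff_space K"
    using K by (auto simp: continuum_def)
  define \<N> where "\<N> = {topspace K \<inter> \<Inter>F | F. finite F \<and> F \<subseteq> (closure_of) K ` \<W>}"
  define \<D> where "\<D> = (\<Union>N\<in>\<N>. {D \<in> connected_components_of (subtopology K N).
    nondegenerate_subcontinuum K D})"
  have N_closed: "closedin K N" if "N \<in> \<N>" for N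
  proof -
    obtain F where F: "N = topspace K \<inter> \<Inter>F" "F \<subseteq> (closure_of) K ` \<W>"
      using \<open>N \<in> \<N>\<close> by (auto simp: \<N>_def)
    then have "closedin K (\<Inter>F)" if "F \<noteq> {}"
      using that by (intro closedin_Inter) auto
    then show ?thesis
      using F(1) by (cases "F = {}") auto
  qed
  have "|\<N>| \<le>o r"
    unfolding \<N>_def
    by (intro finite_Inter_Cinfinite_bound r ordLeq_transitive[OF card_of_image] W)
  then have "|\<D>| \<le>o r"
    unfolding \<D>_def using ordLeq_transitive[OF card_nondegenerate_components_le r(2)]
    by (intro UNION_Cinfinite_bound r(1)) blast+
  moreover have "closedin K D" if "D \<in> \<D>" for D
    using that cK(2) nondegenerate_subcontinuum_closedin unfolding \<D>_def by blast
  moreover have "\<exists>D\<in>\<D>. a \<in> D \<and> D \<subseteq> U" if U: "openin K U" "a \<in> U" and a: "a \<in> A" for a U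
  proof -
    define \<W>\<^sub>a where "\<W>\<^sub>a = {W \<in> \<W>. a \<in> W}"
    have aK: "a \<in> topspace K"
      using openin_subset[OF U(1)] U(2) by blast
    have triv_a: "C \<subseteq> {a}" if "connectedin K C" "a \<in> C" "C \<subseteq> \<Inter>((closure_of) K ` \<W>\<^sub>a)" for C
      using triv a that unfolding \<W>\<^sub>a_def by blast
    have W_cl: "W \<subseteq> K closure_of W" if "W \<in> \<W>\<^sub>a" for W
      using that by (intro closure_of_subset openin_subset) (simp add: W \<W>\<^sub>a_def)
    then have a_cl: "a \<in> N" if "N \<in> (closure_of) K ` \<W>\<^sub>a" for N
      using that by (auto simp: \<W>\<^sub>a_def)
    have cl_closed: "closedin K N" if "N \<in> (closure_of) K ` \<W>\<^sub>a" for N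
      using that by auto
    obtain F where F: "finite F" "F \<subseteq> (closure_of) K ` \<W>\<^sub>a"
      "connected_component_of_set (subtopology K (topspace K \<inter> \<Inter>F)) a \<subseteq> U"
      using component_of_finite_Inter_subset_open[OF cK cl_closed a_cl triv_a U] by blast
    obtain F' where F': "finite F'" "F' \<subseteq> \<W>\<^sub>a" "F = (closure_of) K ` F'"
      using finite_subset_image[OF F(1,2)] by blast
    define N where "N = topspace K \<inter> \<Inter>F"
    define D where "D = connected_component_of_set (subtopology K N) a"
    have NN: "N \<in> \<N>"
      using F(1,2) unfolding N_def \<N>_def \<W>\<^sub>a_def by blast
    define H where "H = topspace K \<inter> \<Inter>F'"
    \<comment> \<open>A small continuum inside the open set \<open>H \<subseteq> N\<close> shows that the component of \<open>a\<close> in \<open>N\<close> is non-degenerate.\<close>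
    have "openin K (\<Inter>F')" if "F' \<noteq> {}"
      using that F' by (intro openin_Inter) (auto simp: W \<W>\<^sub>a_def)
    then have H: "openin K H" "a \<in> H"
      using aK F'(2) unfolding H_def by (cases "F' = {}"; auto simp: \<W>\<^sub>a_def)+
    have HN: "H \<subseteq> N"
      unfolding H_def N_def F'(3) using W_cl F'(2) by blast
    obtain q where "q \<in> topspace K" "q \<noteq> a"
      using two by metis
    then obtain B where B: "nondegenerate_subcontinuum K B" "a \<in> B" "B \<subseteq> H"
      using nondegenerate_subcontinuum_in_open[OF K H] by blast
    then have "connectedin (subtopology K N) B"
      using HN cK by (auto simp: connectedin_subtopology nondegenerate_subcontinuum_iff)
    then have BD: "B \<subseteq> D"
      unfolding D_def using B(2) by (rule connected_component_of_maximal)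
    have "a \<in> topspace (subtopology K N)"
      using H HN aK by auto
    then have Dc: "D \<in> connected_components_of (subtopology K N)"
      unfolding D_def by (simp add: connected_component_in_connected_components_of)
    have "closedin K D"
      using closedin_trans_full[OF closedin_connected_components_of[OF Dc] N_closed[OF NN]] .
    moreover have "connectedin K D"
      using connectedin_connected_components_of[OF Dc] by (simp add: connectedin_subtopology)
    ultimately have "nondegenerate_subcontinuum K D"
      using B(1) BD cK by (auto simp: nondegenerate_subcontinuum_iff)
    then have "D \<in> \<D>"
      using Dc NN unfolding \<D>_def by blast
    then show ?thesis
      using B(2) BD F(3) unfolding D_def N_def by blast
  qed
  ultimately show ?thesis
    by (rule that)
qed

section \<open>Separation by light maps\<close>

lemma zero_dimensional_connectedin_subsingleton:
  assumes Z: "zero_dimensional Z" "Hausdorff_space Z" and C: "connectedin Z C" "x \<in> C" "y \<in> C"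
  shows "x = y"
proof (rule ccontr)
  assume "x \<noteq> y"
  moreover have "x \<in> topspace Z" "y \<in> topspace Z"
    using C connectedin_subset_topspace by blast+
  ultimately obtain U where "openin Z U" "x \<in> U" "y \<notin> U"
    using Z(2) unfolding Hausdorff_space_def disjnt_iff by metis
  then obtain V where V: "openin Z V" "closedin Z V" "x \<in> V" "V \<subseteq> U"
    using Z(1) unfolding zero_dimensional_def is_base_def by blast
  then have "y \<notin> V"
    using \<open>y \<notin> U\<close> by blast
  then show False
    using V C connectedin_clopen_cases[OF C(1) V(2,1)] by (auto simp: disjnt_iff)
qed

lemma maximal_disjoint_family:
  obtains \<M> where "\<And>D. D \<in> \<M> \<Longrightarrow> P D" and "pairwise disjnt \<M>"
    and "\<And>D. P D \<Longrightarrow> D \<noteq> {} \<Longrightarrow> \<exists>M\<in>\<M>. \<not> disjnt D M"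
proof -
  define \<F> where "\<F> = {\<M>. (\<forall>D\<in>\<M>. P D) \<and> pairwise disjnt \<M>}"
  have "\<Union>\<C> \<in> \<F>" if "subset.chain \<F> \<C>" for \<C>
    using that pairwise_chain_Union[of \<C> disjnt]
    unfolding \<F>_def subset_chain_def chain_subset_def by blast
  then obtain \<M> where \<M>: "\<M> \<in> \<F>" "\<forall>\<X>\<in>\<F>. \<M> \<subseteq> \<X> \<longrightarrow> \<X> = \<M>"
    using subset_Zorn'[of \<F>] by blast
  show ?thesis
  proof
    show "P D" if "D \<in> \<M>" for D
      using that \<M>(1) by (simp add: \<F>_def)
    show "pairwise disjnt \<M>"
      using \<M>(1) by (simp add: \<F>_def)
    fix D assume D: "P D" "D \<noteq> {}"
    show "\<exists>M\<in>\<M>. \<not> disjnt D M"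
    proof (rule ccontr)
      assume *: "\<not> (\<exists>M\<in>\<M>. \<not> disjnt D M)"
      then have "insert D \<M> \<in> \<F>"
        using \<M>(1) D by (auto simp: \<F>_def pairwise_insert disjnt_sym)
      then have "D \<in> \<M>"
        using \<M>(2) by blast
      then show False
        using * D(2) by auto
    qed
  qed
qed

text \<open>
  Lightness of \<open>g\<close> keeps a non-degenerate continuum with constant \<open>g\<close> from lying inside \<open>A\<close>. But \<open>K\<close>
  may contain many non-degenerate continua that merely meet \<open>A\<close>; the maximal family \<open>\<M>\<close> of those missing
  \<open>A\<close> is what prevents any of them from surviving all separations.
\<close>

lemma separating_family_of_light_preimage:
  fixes K :: "'k topology" and Y :: "'b topology"
  assumes K: "continuum K" and A: "closedin K A"
    and g: "continuous_map (subtopology K A) Y g"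
    and Y: "regular_space Y" "Hausdorff_space Y" "is_base Y \<B>"
    and light: "\<forall>C y. connectedin K C \<and> C \<subseteq> {a \<in> A. g a = y} \<longrightarrow> (\<exists>x. C \<subseteq> {x})"
    and r: "Cinfinite r" "|\<B>| \<le>o r" "Sln_continuum K \<le>o r"
  obtains \<W> where "|\<W>| \<le>o r" "\<forall>W\<in>\<W>. openin K W"
    "\<forall>a\<in>A. \<forall>C. connectedin K C \<and> a \<in> C \<and> (\<forall>W\<in>\<W>. a \<in> W \<longrightarrow> C \<subseteq> K closure_of W)
      \<longrightarrow> C \<subseteq> {a}"
proof -
  have cK: "compact_space K" "Hausdorff_space K"
    using K by (auto simp: continuum_def)
  have AK: "A \<subseteq> topspace K"
    using A closedin_subset by blast
  then have topA: "topspace (subtopology K A) = A"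
    by auto
  obtain sep where sep: "\<And>S T. closedin K S \<Longrightarrow> closedin K T \<Longrightarrow> disjnt S T \<Longrightarrow>
      openin K (sep S T) \<and> S \<subseteq> sep S T \<and> disjnt T (K closure_of sep S T)"
    using normal_separator compact_Hausdorff_or_regular_imp_normal_space cK by metis
  obtain \<M> where \<M>: "\<And>M. M \<in> \<M> \<Longrightarrow> nondegenerate_subcontinuum K M \<and> disjnt M A"
    "pairwise disjnt \<M>"
    "\<And>D. nondegenerate_subcontinuum K D \<and> disjnt D A \<Longrightarrow> D \<noteq> {} \<Longrightarrow> \<exists>M\<in>\<M>. \<not> disjnt D M"
    using maximal_disjoint_family[of "\<lambda>D. nondegenerate_subcontinuum K D \<and> disjnt D A"] by blast
  define S where "S U = {a \<in> A. g a \<in> Y closure_of U}" for U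
  define T where "T V = {a \<in> A. g a \<notin> V}" for V
  \<comment> \<open>At pairs of sets that are not disjoint, \<open>sep\<close> is arbitrary and need not be open.\<close>
  define \<W> where "\<W> = {W \<in> {sep (S U) (T V) | U V. U \<in> \<B> \<and> V \<in> \<B>} \<union> sep A ` \<M>. openin K W}"
  have S_closed: "closedin K (S U)" for U
    using closedin_trans_full[OF closedin_continuous_map_preimage[OF g closedin_closure_of] A]
    unfolding S_def topA .
  have T_closed: "closedin K (T V)" if "V \<in> \<B>" for V
  proof -
    have "closedin Y (topspace Y - V)"
      using that Y(3) by (auto simp: is_base_def)
    then have "closedin K {a \<in> A. g a \<in> topspace Y - V}"
      using closedin_trans_full[OF closedin_continuous_map_preimage[OF g] A] unfolding topA by blast
    moreover have "g a \<in> topspace Y" if "a \<in> A" for a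
      using that g topA by (auto simp: continuous_map_def)
    ultimately show ?thesis
      unfolding T_def by (metis (mono_tags, lifting) Collect_cong DiffD2 DiffI)
  qed
  have "|sep A ` \<M>| \<le>o r"
    using card_of_image card_le_Sln_continuum[of \<M> K] \<M>(1,2) r(3) ordLeq_transitive by blast
  then have "|{sep (S U) (T V) | U V. U \<in> \<B> \<and> V \<in> \<B>} \<union> sep A ` \<M>| \<le>o r"
    by (intro Un_Cinfinite_bound image_pairs_Cinfinite_bound r)
  then have "|\<W>| \<le>o r"
    by (rule ordLeq_transitive[OF card_of_mono1, rotated]) (auto simp: \<W>_def)
  moreover have "\<forall>W\<in>\<W>. openin K W"
    by (simp add: \<W>_def)
  moreover have "C \<subseteq> {a}" if a: "a \<in> A" and C: "connectedin K C" "a \<in> C"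
    "\<forall>W\<in>\<W>. a \<in> W \<longrightarrow> C \<subseteq> K closure_of W" for a C
  proof (rule ccontr)
    assume "\<not> C \<subseteq> {a}"
    \<comment> \<open>Passing to the closure turns \<open>C\<close> into a subcontinuum with the same containments.\<close>
    define E where "E = K closure_of C"
    have CE: "C \<subseteq> E"
      unfolding E_def by (rule closure_of_subset[OF connectedin_subset_topspace[OF C(1)]])
    have E: "nondegenerate_subcontinuum K E"
      unfolding nondegenerate_subcontinuum_iff[OF cK]
    proof (intro conjI)
      show "closedin K E" "connectedin K E"
        using C(1) by (simp_all add: E_def connectedin_closure_of)
      show "\<exists>x\<in>E. \<exists>y\<in>E. x \<noteq> y"
        using C(2) CE \<open>\<not> C \<subseteq> {a}\<close> by blast
    qed
    have E_cl: "E \<subseteq> K closure_of W" if "W \<in> \<W>" "a \<in> W" for W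
      unfolding E_def using C(3) that by (intro closure_of_minimal) auto
    have E_disj: "disjnt E M" if "M \<in> \<M>" for M
    proof -
      have M: "closedin K M" "disjnt A M"
        using \<M>(1)[OF that] cK(2) nondegenerate_subcontinuum_closedin by (auto simp: disjnt_sym)
      have "sep A M \<in> \<W>"
        using sep[OF A M] that a by (auto simp: \<W>_def)
      then have "E \<subseteq> K closure_of sep A M"
        using E_cl sep[OF A M] a by blast
      then show ?thesis
        using sep[OF A M] by (auto simp: disjnt_iff)
    qed
    have "E \<subseteq> A"
    proof (rule ccontr)
      assume "\<not> E \<subseteq> A"
      then obtain p where p: "p \<in> E" "p \<notin> A"
        by blast
      have contE: "continuum (subtopology K E)" and EK: "E \<subseteq> topspace K"
        using E by (auto simp: nondegenerate_subcontinuum_def)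
      \<comment> \<open>Around \<open>p\<close> there is a continuum that the maximal family should have met.\<close>
      have "openin (subtopology K E) (E - A)"
        using A EK by (metis Int_Diff inf.absorb_iff2 inf_commute openin_diff openin_subtopology_Int2 openin_topspace)
      moreover have "a \<in> topspace (subtopology K E)" "a \<noteq> p"
        using C(2) CE EK p a by auto
      ultimately obtain D where D: "nondegenerate_subcontinuum (subtopology K E) D" "D \<subseteq> E - A"
        using nondegenerate_subcontinuum_in_open[OF contE, of "E - A" p a] p by blast
      then have "nondegenerate_subcontinuum K D"
        using nondegenerate_subcontinuum_trans(1)[OF E] by blast
      then obtain M where "M \<in> \<M>" "\<not> disjnt D M"
        using \<M>(3)[of D] D(2) by (auto simp: disjnt_iff nondegenerate_subcontinuum_def)
      then show False
        using E_disj D(2) by (auto simp: disjnt_iff)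
    qed
    \<comment> \<open>If the values differed, a basic pair around \<open>g a\<close> would yield a separator whose closure misses \<open>b\<close>.\<close>
    have "g b = g a" if "b \<in> E" for b
    proof (rule ccontr)
      assume "g b \<noteq> g a"
      have gab: "g a \<in> topspace Y" "g b \<in> topspace Y"
        using a that \<open>E \<subseteq> A\<close> g topA by (auto simp: continuous_map_def)
      have "openin Y (topspace Y - {g b})"
        using closedin_Hausdorff_singleton[OF Y(2) gab(2)] by blast
      then obtain V where V: "V \<in> \<B>" "g a \<in> V" "V \<subseteq> topspace Y - {g b}"
        using Y(3) gab \<open>g b \<noteq> g a\<close> unfolding is_base_def by (metis DiffI singletonD)
      then have "openin Y V"
        using Y(3) by (auto simp: is_base_def)
      then obtain U' H where "openin Y U'" "closedin Y H" "g a \<in> U'" "U' \<subseteq> H" "H \<subseteq> V"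
        using Y(1) V(2) unfolding neighbourhood_base_of_closedin[symmetric] neighbourhood_base_of
        by metis
      moreover obtain U where U: "U \<in> \<B>" "g a \<in> U" "U \<subseteq> U'"
        using Y(3) \<open>openin Y U'\<close> \<open>g a \<in> U'\<close> unfolding is_base_def by metis
      ultimately have clU: "Y closure_of U \<subseteq> V"
        using closure_of_minimal[of U H Y] by blast
      have dis: "disjnt (S U) (T V)"
        using clU by (auto simp: S_def T_def disjnt_iff)
      have "openin Y U"
        using U(1) Y(3) by (simp add: is_base_def)
      then have "g a \<in> Y closure_of U"
        using closure_of_subset[OF openin_subset] U(2) by blast
      then have "a \<in> S U"
        using a by (simp add: S_def)
      then have "sep (S U) (T V) \<in> \<W>"
        using sep[OF S_closed T_closed[OF V(1)] dis] U(1) V(1) by (auto simp: \<W>_def)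
      moreover have "a \<in> sep (S U) (T V)"
        using sep[OF S_closed T_closed[OF V(1)] dis] \<open>a \<in> S U\<close> by blast
      ultimately have "b \<notin> T V"
        using E_cl that sep[OF S_closed T_closed[OF V(1)] dis] by (meson disjnt_iff subsetD)
      then show False
        using that \<open>E \<subseteq> A\<close> V(3) by (auto simp: T_def)
    qed
    then have "E \<subseteq> {b \<in> A. g b = g a}"
      using \<open>E \<subseteq> A\<close> by blast
    moreover have "connectedin K E"
      using C(1) by (simp add: E_def connectedin_closure_of)
    ultimately obtain x where "E \<subseteq> {x}"
      using light by blast
    then show False
      using CE C(2) \<open>\<not> C \<subseteq> {a}\<close> by blast
  qed
  ultimately show ?thesis
    using that by metis
qed

section \<open>The weight of the domain of a light map\<close>

theorem theorem1:
  fixes X :: "'a topology" and Y :: "'b topology" and f :: "'a \<Rightarrow> 'b"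
  assumes "compact_space X" and "Hausdorff_space X"
    and "compact_space Y" and "Hausdorff_space Y"
    and "light_map X Y f"
    and not_singleton: "\<not> (\<exists>a. topspace X = {a})"
    and "embeds_in_continuum TYPE('k) X"
  shows "weight X \<le>o weight Y *c Sln TYPE('k) X"
proof (cases "topspace X = {}")
  case True
  then have "is_base X {}"
    unfolding is_base_def by (metis empty_iff openin_subset subset_eq)
  then have "weight X \<le>o |{} :: 'a set set|"
    by (rule weight_le)
  also have "|{} :: 'a set set| \<le>o weight Y *c Sln TYPE('k) X"
    by (rule card_of_empty1) (simp add: Card_order_cprod)
  finally show ?thesis .
next
  case False
  have "Sln TYPE('k) X \<in> {Sln_continuum K | K :: 'k topology. continuum K \<and> (\<exists>e. embedding_map X K e)}"
    unfolding Sln_def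
    by (rule card_min(1)) (use assms(7) in \<open>auto simp: embeds_in_continuum_def Card_order_Sln_continuum\<close>)
  then obtain K :: "'k topology" and e where K: "Sln TYPE('k) X = Sln_continuum K" "continuum K"
    and e: "embedding_map X K e"
    by blast
  define A where "A = e ` topspace X"
  obtain h where h: "homeomorphic_maps X (subtopology K A) e h"
    using e unfolding embedding_map_def homeomorphic_map_maps A_def by blast
  then have e_cont: "continuous_map X K e" and h_cont: "continuous_map (subtopology K A) X h"
    and he: "\<And>x. x \<in> topspace X \<Longrightarrow> h (e x) = x"
    by (auto simp: homeomorphic_maps_def continuous_map_in_subtopology)
  have inj: "inj_on e (topspace X)"
    using he by (metis inj_onI)
  have A: "closedin K A"
    unfolding A_def using assms(1) e_cont K(2) image_compactin compactin_imp_closedin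
    by (metis compact_space_def continuum_def)
  have two: "\<exists>p\<in>topspace K. \<exists>q\<in>topspace K. p \<noteq> q"
  proof -
    obtain x y where "x \<in> topspace X" "y \<in> topspace X" "x \<noteq> y"
      using False not_singleton by blast
    then show ?thesis
      using inj e_cont unfolding continuous_map_def inj_on_def by blast
  qed
  have Sln: "Cinfinite (Sln TYPE('k) X)"
    using K two Cinfinite_Sln_continuum by metis
  obtain \<B> where \<B>: "is_base Y \<B>" "weight Y = |\<B>|"
    by (rule weight_attained)
  have f: "continuous_map X Y f"
    and fibre: "\<And>y. y \<in> topspace Y \<Longrightarrow> zero_dimensional (subtopology X {x \<in> topspace X. f x = y})"
    using assms(5) by (auto simp: light_map_def)
  have "\<B> \<noteq> {}"
    using False f \<B>(1) unfolding is_base_def continuous_map_def by (metis Pi_iff all_not_in_conv openin_topspace)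
  then have wY: "Cnotzero (weight Y)"
    using \<B>(2) by (metis card_of_Card_order Field_card_of czeroE)
  define r where "r = weight Y *c Sln TYPE('k) X"
  have r: "Cinfinite r" "|\<B>| \<le>o r" "Sln_continuum K \<le>o r"
  proof -
    show "Cinfinite r"
      unfolding r_def by (rule Cinfinite_cprod2[OF wY Sln])
    show "Sln_continuum K \<le>o r"
      unfolding r_def K(1)[symmetric] using wY Sln by (intro ordLeq_cprod2) auto
    show "|\<B>| \<le>o r"
      unfolding r_def \<B>(2) cprod_def Field_card_of
      by (rule card_of_Times1) (use Sln in \<open>auto simp: cinfinite_def\<close>)
  qed
  have "\<exists>x. C \<subseteq> {x}" if C: "connectedin K C" "C \<subseteq> {a \<in> A. (f \<circ> h) a = y}" for C y
  proof (cases "C = {}")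
    case False
    then obtain x where x: "x \<in> C"
      by blast
    have CA: "C \<subseteq> A"
      using C(2) by blast
    let ?F = "{z \<in> topspace X. f z = y}"
    have AX: "h z \<in> topspace X" "e (h z) = z" if "z \<in> A" for z
      using that he by (auto simp: A_def)
    have "connectedin (subtopology K A) C"
      using C(1) CA by (simp add: connectedin_subtopology)
    then have "connectedin X (h ` C)"
      by (rule connectedin_continuous_map_image[OF h_cont])
    then have "connectedin (subtopology X ?F) (h ` C)"
      using C(2) AX by (auto simp: connectedin_subtopology)
    moreover have "y \<in> topspace Y"
      using C(2) x AX(1) f by (auto simp: continuous_map_def)
    then have "zero_dimensional (subtopology X ?F)"
      by (rule fibre)
    ultimately have "h z = h x" if "z \<in> C" for z
      using zero_dimensional_connectedin_subsingleton[OF _ Hausdorff_space_subtopology[OF assms(2)]]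
        x that by blast
    then have "C \<subseteq> {x}"
      using AX(2) CA x by (metis singleton_iff subset_iff)
    then show ?thesis ..
  qed simp
  then have light: "\<forall>C y. connectedin K C \<and> C \<subseteq> {a \<in> A. (f \<circ> h) a = y} \<longrightarrow> (\<exists>x. C \<subseteq> {x})"
    by blast
  obtain \<W> where \<W>: "|\<W>| \<le>o r" "\<forall>W\<in>\<W>. openin K W"
    "\<forall>a\<in>A. \<forall>C. connectedin K C \<and> a \<in> C \<and> (\<forall>W\<in>\<W>. a \<in> W \<longrightarrow> C \<subseteq> K closure_of W)
      \<longrightarrow> C \<subseteq> {a}"
    by (rule separating_family_of_light_preimage[OF K(2) A continuous_map_compose[OF h_cont f]
        compact_Hausdorff_imp_regular_space[OF assms(3,4)] assms(4) \<B>(1) light r])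
  obtain \<D> where \<D>: "|\<D>| \<le>o r" "\<And>D. D \<in> \<D> \<Longrightarrow> closedin K D"
    "\<And>a U. openin K U \<Longrightarrow> a \<in> A \<Longrightarrow> a \<in> U \<Longrightarrow> \<exists>D\<in>\<D>. a \<in> D \<and> D \<subseteq> U"
    using closed_network_of_components[OF K(2) two \<W>(1,2) \<W>(3) r(1,3)]
    by blast
  have "weight X \<le>o r"
  proof (rule weight_le_closed_network[OF assms(1,2) r(1)])
    show "|(\<lambda>D. {x \<in> topspace X. e x \<in> D}) ` \<D>| \<le>o r"
      by (rule ordLeq_transitive[OF card_of_image \<D>(1)])
    show "closedin X D" if "D \<in> (\<lambda>D. {x \<in> topspace X. e x \<in> D}) ` \<D>" for D
      using that \<D>(2) closedin_continuous_map_preimage[OF e_cont] by blast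
    fix x U assume U: "openin X U" "x \<in> U"
    then have UX: "U \<subseteq> topspace X"
      using openin_subset by blast
    have "openin (subtopology K A) (e ` U)"
      using h U(1) homeomorphic_maps_imp_map homeomorphic_map_openness UX by metis
    then obtain V where V: "openin K V" "e ` U = V \<inter> A"
      by (auto simp: openin_subtopology)
    have "e x \<in> V" "e x \<in> A"
      using U(2) V(2) by auto
    then obtain D where D: "D \<in> \<D>" "e x \<in> D" "D \<subseteq> V"
      using \<D>(3)[OF V(1)] by blast
    have "z \<in> U" if "z \<in> topspace X" "e z \<in> D" for z
    proof -
      have "e z \<in> e ` U"
        using that D(3) V(2) by (auto simp: A_def)
      then show ?thesis
        using inj that UX by (auto simp: inj_on_def)
    qed
    then show "\<exists>D\<in>(\<lambda>D. {x \<in> topspace X. e x \<in> D}) ` \<D>. x \<in> D \<and> D \<subseteq> U"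
      using D(1,2) U(2) UX by (intro bexI[OF _ imageI[OF D(1)]]) auto
  qed
  then show ?thesis
    by (simp add: r_def)
qed

end
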